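(* Let $\alpha,\beta,\gamma,\delta\in\mathbb C$ and let $p_1(z)=\gamma+\delta z$ and $p_2(z)=(\alpha+\beta z)(\gamma+\delta z)$. Assume that $|p_1(z)|^2+|p_2(z)|\le 1$ for all $z\in\mathbb D$. If either $\alpha\beta\gamma\delta=0$ or $\arg(\alpha)-\arg(\beta)=\arg(\gamma)-\arg(\delta)$, then $\mathscr T(M_{p_1},M_{p_2})$ is completely polynomially extendible.
   Context: $\mathbb D$ is the open unit disc, $\mathbb T$ the unit circle. For $\phi\in L^\infty(\mathbb T)$, $M_\phi$ is multiplication by $\phi$ on $L^2(\mathbb T)$. The argument condition is for nonzero numbers, with arguments understood modulo $2\pi$. For operators $A_1,\dots,A_n$ on a Hilbert space $\mathbb H$, $\mathscr T(A_1,\dots,A_n)$ is the $n\times n$ block upper triangular Toeplitz operator on $\mathbb H\otimes\mathbb C^n$ whose $(i,j)$ block is $A_{j-i+1}$ for $j\ge i$ and $0$ for $j<i$. Let $p_1,\dots,p_k$ be one-variable polynomials with $\deg p_j\le j$. The operator $\mathscr T(M_{p_1},\dots,M_{p_k})$ is $m$-polynomially extendible ($m\geq k$) if $\|\mathscr T(M_{p_1},\dots,M_{p_k})\|\le1$ and there are polynomials $p_{k+1},\dots,p_m$ with $\deg p_l\le l$ such that $\|\mathscr T(M_{p_1},\dots,M_{p_m})\|\le1$. It is completely polynomially extendible if it is $m$-polynomially extendible for all $m\ge k$. *)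

theory Defs
  imports
    "HOL-Analysis.Analysis"
    "HOL-Computational_Algebra.Polynomial"
    "HOL-Library.Real_Mod"
begin

section \<open>The Hilbert space \<open>L\<^sup>2\<close> of the unit circle\<close>

text \<open>Normalised arc length measure on the unit circle.\<close>

definition circle_measure :: "complex measure" where
  "circle_measure =
     distr (uniform_measure lborel {0..<2 * pi}) (restrict_space borel (sphere 0 1)) cis"

lemma cis_measurable_sphere: "cis \<in> borel \<rightarrow>\<^sub>M restrict_space borel (sphere 0 1)"
  by (rule measurable_restrict_space2)
    (auto intro!: borel_measurable_continuous_onI continuous_intros)

lemma emeasure_circle_measure_sphere: "emeasure circle_measure (sphere 0 1) = 1"
proof -
  have "cis \<in> uniform_measure lborel {0..<2 * pi} \<rightarrow>\<^sub>M restrict_space borel (sphere 0 1)"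
    using cis_measurable_sphere by (simp cong: measurable_cong_sets)
  then have "emeasure circle_measure (sphere 0 1)
      = emeasure (uniform_measure lborel {0..<2 * pi}) (cis -` sphere 0 1 \<inter> UNIV)"
    unfolding circle_measure_def
    by (subst emeasure_distr) (auto simp: sets_restrict_space_iff)
  also have "cis -` sphere 0 1 \<inter> UNIV = UNIV" by auto
  also have "emeasure (uniform_measure lborel {0..<2 * pi}) UNIV = 1"
    by (subst emeasure_uniform_measure) (auto simp: ennreal_zero_less_divide intro!: ennreal_divide_self)
  finally show ?thesis .
qed

definition square_integrable :: "(complex \<Rightarrow> complex) \<Rightarrow> bool" where
  "square_integrable f \<longleftrightarrow>
     f \<in> borel_measurable circle_measure \<and> integrable circle_measure (\<lambda>z. (norm (f z))\<^sup>2)"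

definition L2_rel :: "(complex \<Rightarrow> complex) \<Rightarrow> (complex \<Rightarrow> complex) \<Rightarrow> bool" where
  "L2_rel f g \<longleftrightarrow>
     square_integrable f \<and> square_integrable g \<and> (AE z in circle_measure. f z = g z)"

lemma square_integrable_zero: "square_integrable (\<lambda>z. 0)"
  by (simp add: square_integrable_def)

lemma square_integrable_add:
  assumes "square_integrable f" "square_integrable g"
  shows "square_integrable (\<lambda>z. f z + g z)"
proof -
  have [measurable]: "f \<in> borel_measurable circle_measure" "g \<in> borel_measurable circle_measure"
    using assms by (auto simp: square_integrable_def)
  have "integrable circle_measure (\<lambda>z. (norm (f z + g z))\<^sup>2)"
  proof (rule Bochner_Integration.integrable_bound)
    show "integrable circle_measure (\<lambda>z. 2 * (norm (f z))\<^sup>2 + 2 * (norm (g z))\<^sup>2)"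
      using assms by (auto simp: square_integrable_def)
    have "(norm (f z + g z))\<^sup>2 \<le> 2 * (norm (f z))\<^sup>2 + 2 * (norm (g z))\<^sup>2" for z
    proof -
      have "(norm (f z + g z))\<^sup>2 \<le> (norm (f z) + norm (g z))\<^sup>2"
        by (intro power_mono norm_triangle_ineq) auto
      also have "\<dots> \<le> 2 * (norm (f z))\<^sup>2 + 2 * (norm (g z))\<^sup>2"
        using sum_squares_bound[of "norm (f z)" "norm (g z)"] by (simp add: power2_sum)
      finally show ?thesis .
    qed
    then show "AE z in circle_measure. norm ((norm (f z + g z))\<^sup>2)
        \<le> norm (2 * (norm (f z))\<^sup>2 + 2 * (norm (g z))\<^sup>2)"
      by (intro AE_I2) simp
  qed measurable
  then show ?thesis by (simp add: square_integrable_def)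
qed

lemma square_integrable_mult:
  assumes "square_integrable f" "\<phi> \<in> borel_measurable circle_measure"
    and "AE z in circle_measure. norm (\<phi> z) \<le> C"
  shows "square_integrable (\<lambda>z. \<phi> z * f z)"
proof -
  have [measurable]: "f \<in> borel_measurable circle_measure" "\<phi> \<in> borel_measurable circle_measure"
    using assms by (auto simp: square_integrable_def)
  have "integrable circle_measure (\<lambda>z. (norm (\<phi> z * f z))\<^sup>2)"
  proof (rule Bochner_Integration.integrable_bound)
    show "integrable circle_measure (\<lambda>z. C\<^sup>2 * (norm (f z))\<^sup>2)"
      using assms by (auto simp: square_integrable_def)
    show "AE z in circle_measure. norm ((norm (\<phi> z * f z))\<^sup>2) \<le> norm (C\<^sup>2 * (norm (f z))\<^sup>2)"
      using assms(3)
      by eventually_elim (auto simp: norm_mult power_mult_distrib intro!: mult_right_mono power_mono)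
  qed measurable
  then show ?thesis by (simp add: square_integrable_def)
qed

lemma square_integrable_scaleR:
  assumes "square_integrable f" shows "square_integrable (\<lambda>z. r *\<^sub>R f z)"
  using square_integrable_mult[OF assms, of "\<lambda>_. of_real r" "\<bar>r\<bar>"]
  by (simp add: scaleR_conv_of_real)

lemma square_integrable_minus:
  assumes "square_integrable f" shows "square_integrable (\<lambda>z. - f z)"
  using square_integrable_scaleR[OF assms, of "-1"] by simp

lemma square_integrable_diff:
  assumes "square_integrable f" "square_integrable g"
  shows "square_integrable (\<lambda>z. f z - g z)"
  using square_integrable_add[OF assms(1) square_integrable_minus[OF assms(2)]] by simp

lemma integrable_inner_square_integrable:
  assumes "square_integrable f" "square_integrable g"
  shows "integrable circle_measure (\<lambda>z. inner (f z) (g z))"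
proof -
  have [measurable]: "f \<in> borel_measurable circle_measure" "g \<in> borel_measurable circle_measure"
    using assms by (auto simp: square_integrable_def)
  show ?thesis
  proof (rule Bochner_Integration.integrable_bound)
    show "integrable circle_measure (\<lambda>z. (norm (f z))\<^sup>2 + (norm (g z))\<^sup>2)"
      using assms by (auto simp: square_integrable_def)
    have "norm (inner (f z) (g z)) \<le> (norm (f z))\<^sup>2 + (norm (g z))\<^sup>2" for z
    proof -
      have "\<bar>inner (f z) (g z)\<bar> \<le> norm (f z) * norm (g z)"
        by (rule Cauchy_Schwarz_ineq2)
      also have "\<dots> \<le> 2 * norm (f z) * norm (g z)" by simp
      also have "\<dots> \<le> (norm (f z))\<^sup>2 + (norm (g z))\<^sup>2"
        by (rule sum_squares_bound)
      finally show ?thesis by simp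
    qed
    then show "AE z in circle_measure. norm (inner (f z) (g z))
        \<le> norm ((norm (f z))\<^sup>2 + (norm (g z))\<^sup>2)"
      by (intro AE_I2) simp
  qed measurable
qed

quotient_type circle_L2 = "complex \<Rightarrow> complex" / partial: L2_rel
proof (rule part_equivpI)
  show "\<exists>f. L2_rel f f"
    using square_integrable_zero by (auto simp: L2_rel_def)
  show "symp L2_rel"
    by (auto simp: L2_rel_def intro!: sympI)
  show "transp L2_rel"
    by (auto simp: L2_rel_def intro!: transpI elim: eventually_elim2)
qed

text \<open>
  The pointwise \<^const>\<open>inner\<close> on \<^typ>\<open>complex\<close> is the real part of the Hermitian product, so the
  real inner product below is the real part of the Hermitian inner product of \<open>L\<^sup>2\<close>; the norm
  is the usual one (see \<open>norm_circle_L2\<close> below).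
\<close>

instantiation circle_L2 :: real_inner
begin

lift_definition zero_circle_L2 :: circle_L2 is "\<lambda>z. 0"
  by (simp add: L2_rel_def square_integrable_zero)

lift_definition plus_circle_L2 :: "circle_L2 \<Rightarrow> circle_L2 \<Rightarrow> circle_L2" is "\<lambda>f g z. f z + g z"
  by (auto simp: L2_rel_def square_integrable_add elim: eventually_elim2)

lift_definition minus_circle_L2 :: "circle_L2 \<Rightarrow> circle_L2 \<Rightarrow> circle_L2" is "\<lambda>f g z. f z - g z"
  by (auto simp: L2_rel_def square_integrable_diff elim: eventually_elim2)

lift_definition uminus_circle_L2 :: "circle_L2 \<Rightarrow> circle_L2" is "\<lambda>f z. - f z"
  by (auto simp: L2_rel_def square_integrable_minus)

lift_definition scaleR_circle_L2 :: "real \<Rightarrow> circle_L2 \<Rightarrow> circle_L2" is "\<lambda>r f z. r *\<^sub>R f z"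
  by (auto simp: L2_rel_def square_integrable_scaleR elim: eventually_mono)

lift_definition inner_circle_L2 :: "circle_L2 \<Rightarrow> circle_L2 \<Rightarrow> real" is
  "\<lambda>f g. \<integral>z. inner (f z) (g z) \<partial>circle_measure"
  by (rule integral_cong_AE) (auto simp: L2_rel_def square_integrable_def)

definition norm_circle_L2 :: "circle_L2 \<Rightarrow> real" where
  "norm_circle_L2 f = sqrt (inner f f)"

definition dist_circle_L2 :: "circle_L2 \<Rightarrow> circle_L2 \<Rightarrow> real" where
  "dist_circle_L2 f g = norm (f - g)"

definition sgn_circle_L2 :: "circle_L2 \<Rightarrow> circle_L2" where
  "sgn_circle_L2 f = inverse (norm f) *\<^sub>R f"

definition uniformity_circle_L2 :: "(circle_L2 \<times> circle_L2) filter" where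
  "uniformity_circle_L2 = (INF e\<in>{0<..}. principal {(f, g). dist f g < e})"

definition open_circle_L2 :: "circle_L2 set \<Rightarrow> bool" where
  "open_circle_L2 U \<longleftrightarrow> (\<forall>f\<in>U. eventually (\<lambda>(f', g). f' = f \<longrightarrow> g \<in> U) uniformity)"

instance
proof
  fix f g h :: circle_L2 and r s :: real
  show "f + g + h = f + (g + h)"
    by transfer (auto simp: L2_rel_def square_integrable_add algebra_simps)
  show "f + g = g + f"
    by transfer (auto simp: L2_rel_def square_integrable_add algebra_simps)
  show "0 + f = f"
    by transfer (auto simp: L2_rel_def)
  show "- f + f = 0"
    by transfer (auto simp: L2_rel_def square_integrable_zero)
  show "f - g = f + - g"
    by transfer (auto simp: L2_rel_def square_integrable_diff)
  show "r *\<^sub>R (f + g) = r *\<^sub>R f + r *\<^sub>R g"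
    by transfer
      (auto simp: L2_rel_def square_integrable_add square_integrable_scaleR scaleR_right_distrib)
  show "(r + s) *\<^sub>R f = r *\<^sub>R f + s *\<^sub>R f"
    by transfer
      (auto simp: L2_rel_def square_integrable_add square_integrable_scaleR scaleR_left_distrib)
  show "r *\<^sub>R s *\<^sub>R f = (r * s) *\<^sub>R f"
    by transfer (auto simp: L2_rel_def square_integrable_scaleR)
  show "1 *\<^sub>R f = f"
    by transfer (auto simp: L2_rel_def)
  show "dist f g = norm (f - g)" by (rule dist_circle_L2_def)
  show "sgn f = inverse (norm f) *\<^sub>R f" by (rule sgn_circle_L2_def)
  show "uniformity = (INF e\<in>{0<..}. principal {(f, g :: circle_L2). dist f g < e})"
    by (rule uniformity_circle_L2_def)
  show "open U \<longleftrightarrow> (\<forall>f\<in>U. eventually (\<lambda>(f', g). f' = f \<longrightarrow> g \<in> U) uniformity)"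
    for U :: "circle_L2 set"
    by (rule open_circle_L2_def)
  show "inner f g = inner g f"
    by transfer (simp add: inner_commute)
  show "inner (f + g) h = inner f h + inner g h"
    by transfer (simp add: L2_rel_def inner_add_left integrable_inner_square_integrable)
  show "inner (r *\<^sub>R f) g = r * inner f g"
    by transfer simp
  show "0 \<le> inner f f"
    by transfer (simp add: integral_nonneg_AE)
  show "inner f f = 0 \<longleftrightarrow> f = 0"
  proof transfer
    fix f assume "L2_rel f f"
    then have f: "square_integrable f" by (simp add: L2_rel_def)
    have "(\<integral>z. inner (f z) (f z) \<partial>circle_measure) = 0
        \<longleftrightarrow> (AE z in circle_measure. inner (f z) (f z) = 0)"
      by (rule integral_nonneg_eq_0_iff_AE) (use f in \<open>auto intro: integrable_inner_square_integrable\<close>)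
    then show "(\<integral>z. inner (f z) (f z) \<partial>circle_measure) = 0 \<longleftrightarrow> L2_rel f (\<lambda>z. 0)"
      using f by (simp add: L2_rel_def square_integrable_zero)
  qed
  show "norm f = sqrt (inner f f)" by (rule norm_circle_L2_def)
qed

end

lift_definition L2_class :: "(complex \<Rightarrow> complex) \<Rightarrow> circle_L2" is
  "\<lambda>f. if square_integrable f then f else (\<lambda>z. 0)"
  by (simp add: L2_rel_def square_integrable_zero)

lemma norm_circle_L2:
  assumes "square_integrable f"
  shows "norm (L2_class f) = sqrt (\<integral>z. (norm (f z))\<^sup>2 \<partial>circle_measure)"
proof -
  have "inner (L2_class f) (L2_class f) = (\<integral>z. (norm (f z))\<^sup>2 \<partial>circle_measure)"
    using assms by transfer (simp add: power2_norm_eq_inner)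
  then show ?thesis by (simp add: norm_eq_sqrt_inner)
qed


section \<open>Multiplication operators\<close>

definition ess_bounded :: "(complex \<Rightarrow> complex) \<Rightarrow> bool" where
  "ess_bounded \<phi> \<longleftrightarrow>
     \<phi> \<in> borel_measurable circle_measure \<and> (\<exists>C. AE z in circle_measure. norm (\<phi> z) \<le> C)"

text \<open>Junk value \<open>0\<close> for symbols outside \<open>L\<^sup>\<infinity>\<close>; polynomials are never affected.\<close>

lift_definition mult_op :: "(complex \<Rightarrow> complex) \<Rightarrow> circle_L2 \<Rightarrow> circle_L2" is
  "\<lambda>\<phi> f z. if ess_bounded \<phi> then \<phi> z * f z else 0"
proof -
  fix \<phi> f g assume fg: "L2_rel f g"
  show "L2_rel (\<lambda>z. if ess_bounded \<phi> then \<phi> z * f z else 0)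
      (\<lambda>z. if ess_bounded \<phi> then \<phi> z * g z else 0)"
  proof (cases "ess_bounded \<phi>")
    case True
    then obtain C where "\<phi> \<in> borel_measurable circle_measure"
        "AE z in circle_measure. norm (\<phi> z) \<le> C"
      by (auto simp: ess_bounded_def)
    with fg True show ?thesis
      by (auto simp: L2_rel_def intro: square_integrable_mult elim: eventually_mono)
  qed (simp add: L2_rel_def square_integrable_zero)
qed

lemma measurable_circle_measure:
  "borel_measurable circle_measure = borel_measurable (restrict_space borel (sphere 0 1))"
  by (rule measurable_cong_sets) (auto simp: circle_measure_def)

lemma ess_bounded_poly: "ess_bounded (poly p)"
proof -
  have cont: "continuous_on (sphere 0 1) (poly p)"
    by (intro continuous_intros)
  then have "bounded (poly p ` sphere 0 1)"
    by (intro compact_imp_bounded compact_continuous_image) auto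
  then obtain C where C: "\<And>z. z \<in> sphere 0 1 \<Longrightarrow> norm (poly p z) \<le> C"
    unfolding bounded_iff by blast
  have "AE z in circle_measure. norm (poly p z) \<le> C"
    by (rule AE_I2) (auto simp: circle_measure_def space_restrict_space intro!: C)
  moreover have "poly p \<in> borel_measurable circle_measure"
    using borel_measurable_continuous_on_restrict[OF cont] by (simp add: measurable_circle_measure)
  ultimately show ?thesis by (auto simp: ess_bounded_def)
qed

lemma mult_op_poly:
  assumes "square_integrable f"
  shows "mult_op (poly p) (L2_class f) = L2_class (\<lambda>z. poly p z * f z)"
proof -
  obtain C where "poly p \<in> borel_measurable circle_measure"
      "AE z in circle_measure. norm (poly p z) \<le> C"
    using ess_bounded_poly[of p] by (auto simp: ess_bounded_def)
  then have "square_integrable (\<lambda>z. poly p z * f z)"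
    using assms by (intro square_integrable_mult)
  then show ?thesis
    using assms ess_bounded_poly[of p] by transfer (simp add: L2_rel_def)
qed


section \<open>Block Toeplitz operators\<close>

text \<open>
  An element of \<open>\<H> \<otimes> \<complex>\<^sup>n\<close>, i.e. an \<open>n\<close>-tuple of vectors, is a function \<open>x :: nat \<Rightarrow> 'h\<close> of
  which only the entries \<open>x i\<close> with \<open>i < n\<close> count; block indices start at \<open>0\<close>.
  Norms take values in \<^typ>\<open>ereal\<close> so that the supremum is meaningful without a boundedness
  side condition. Only the norm of the Hilbert space enters, so the underlying real inner
  product structure suffices.
\<close>

definition tuple_norm :: "nat \<Rightarrow> (nat \<Rightarrow> 'h::real_inner) \<Rightarrow> real" where
  "tuple_norm n x = L2_set (\<lambda>i. norm (x i)) {..<n}"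

definition block_op :: "nat \<Rightarrow> (nat \<Rightarrow> nat \<Rightarrow> 'h \<Rightarrow> 'h) \<Rightarrow> (nat \<Rightarrow> 'h) \<Rightarrow> (nat \<Rightarrow> 'h::real_inner)" where
  "block_op n B x = (\<lambda>i. \<Sum>j<n. B i j (x j))"

definition block_op_norm :: "nat \<Rightarrow> ((nat \<Rightarrow> 'h) \<Rightarrow> (nat \<Rightarrow> 'h::real_inner)) \<Rightarrow> ereal" where
  "block_op_norm n T = (SUP x\<in>{x. tuple_norm n x \<le> 1}. ereal (tuple_norm n (T x)))"

text \<open>
  For \<open>As = [A\<^sub>1, \<dots>, A\<^sub>n]\<close>, list indexing shifts as well: \<open>As ! (j - i)\<close> is \<open>A\<^bsub>j-i+1\<^esub>\<close>.
\<close>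

definition toeplitz :: "('h \<Rightarrow> 'h) list \<Rightarrow> (nat \<Rightarrow> 'h) \<Rightarrow> (nat \<Rightarrow> 'h::real_inner)" where
  "toeplitz As = block_op (length As) (\<lambda>i j. if i \<le> j then As ! (j - i) else (\<lambda>_. 0))"

definition toeplitz_norm :: "('h \<Rightarrow> 'h::real_inner) list \<Rightarrow> ereal" where
  "toeplitz_norm As = block_op_norm (length As) (toeplitz As)"

definition mult_ops :: "complex poly list \<Rightarrow> (circle_L2 \<Rightarrow> circle_L2) list" where
  "mult_ops ps = map (\<lambda>p. mult_op (poly p)) ps"


section \<open>Polynomial extendibility\<close>

text \<open>
  \<open>ps = [p\<^sub>1, \<dots>, p\<^sub>k]\<close> is extended by \<open>qs = [p\<^bsub>k+1\<^esub>, \<dots>, p\<^sub>m]\<close>. The bounds \<open>deg p\<^sub>j \<le> j\<close> for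
  \<open>j \<le> k\<close> are a standing assumption on \<open>ps\<close>, not part of the notion.
\<close>

definition poly_extendible :: "nat \<Rightarrow> complex poly list \<Rightarrow> bool" where
  "poly_extendible m ps \<longleftrightarrow>
     toeplitz_norm (mult_ops ps) \<le> 1 \<and>
     (\<exists>qs. length ps + length qs = m \<and>
           (\<forall>l\<in>{length ps + 1..m}. degree ((ps @ qs) ! (l - 1)) \<le> l) \<and>
           toeplitz_norm (mult_ops (ps @ qs)) \<le> 1)"

definition completely_poly_extendible :: "complex poly list \<Rightarrow> bool" where
  "completely_poly_extendible ps \<longleftrightarrow> (\<forall>m\<ge>length ps. poly_extendible m ps)"

end

theory Submission
  imports Defs
begin

text \<open>
  Put \<open>C = \<bar>\<gamma>\<bar> + \<bar>\<delta>\<bar>\<close> and \<open>A = \<bar>\<alpha>\<bar> + \<bar>\<beta>\<bar>\<close>. The argument condition (or the vanishing of one of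
  the coefficients) provides a point of the circle where \<open>\<gamma> + \<delta> z\<close> and \<open>\<alpha> + \<beta> z\<close> attain their
  maximal moduli \<open>C\<close> and \<open>A\<close> simultaneously, so the hypothesis amounts to \<open>C\<^sup>2 + A C \<le> 1\<close>. Let
  \<open>\<mu> = \<alpha> + \<beta> z\<close> and \<open>\<nu> = C \<mu> / (1 - C\<^sup>2)\<close>, so that \<open>\<bar>\<nu>\<bar> \<le> 1\<close> on the circle, and let
  \<open>\<phi>(w) = (C + w) / (1 + C w)\<close>. The function \<open>w \<mapsto> (p\<^sub>1 / C) \<phi>(\<nu> w)\<close> is bounded by 1 on the
  disc, and its Taylor coefficients \<open>p\<^sub>1, p\<^sub>1 \<mu>, p\<^sub>1 \<mu> (- C \<nu>), p\<^sub>1 \<mu> (- C \<nu>)\<^sup>2, \<dots>\<close> are polynomials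
  of degrees at most \<open>1, 2, 3, \<dots>\<close> in \<open>z\<close> which start with \<open>p\<^sub>1, p\<^sub>2\<close>.
\<close>

section \<open>Contractive scalar Toeplitz matrices\<close>

text \<open>The cross terms \<open>2 * c * inner x y\<close> on the left cancel. This is the vector
  form of the identity |1 + c w|^2 - |c + w|^2 = (1 - c^2)(1 - |w|^2) behind the Moebius maps of the
  disc.\<close>

lemma moebius_norm_diff:
  fixes x y :: "'a::real_inner"
  shows "(norm (x + c *\<^sub>R y))\<^sup>2 - (norm (c *\<^sub>R x + y))\<^sup>2
    = (1 - c\<^sup>2) * ((norm x)\<^sup>2 - (norm y)\<^sup>2)"
  unfolding power2_norm_eq_inner
  by (simp add: inner_add_left inner_add_right inner_commute[of y x] algebra_simps power2_eq_square)

text \<open>Taylor coefficients in w of (c + \<nu> w) / (1 + c \<nu> w).\<close>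

definition moebius_coeff :: "real \<Rightarrow> complex \<Rightarrow> nat \<Rightarrow> complex" where
  "moebius_coeff c \<nu> k =
     (case k of 0 \<Rightarrow> of_real c | Suc l \<Rightarrow> of_real (1 - c\<^sup>2) * \<nu> * (- of_real c * \<nu>) ^ l)"

text \<open>
  With \<open>N\<close> the shift multiplied by \<open>\<nu>\<close>, the matrix is \<open>(c + N) (1 + c N)\<^sup>-\<^sup>1\<close>. The vector \<open>\<eta>\<close> is
  \<open>(1 + c N)\<^sup>-\<^sup>1 x\<close>.
\<close>

lemma moebius_toeplitz_contractive:
  fixes x :: "nat \<Rightarrow> complex"
  assumes c: "0 \<le> c" "c \<le> 1" and \<nu>: "norm \<nu> \<le> 1"
  shows "(\<Sum>i<n. (norm (\<Sum>j=i..<n. moebius_coeff c \<nu> (j - i) * x j))\<^sup>2) \<le> (\<Sum>i<n. (norm (x i))\<^sup>2)"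
proof -
  define \<eta> where "\<eta> i = (\<Sum>j=i..<n. (- of_real c * \<nu>) ^ (j - i) * x j)" for i
  define y where "y i = (\<Sum>j=i..<n. moebius_coeff c \<nu> (j - i) * x j)" for i
  \<comment> \<open>\<open>x_eq\<close> and \<open>y_eq\<close> are the rows of x = (1 + c N) \<eta>
    and y = (c + N) \<eta>. In the last row \<open>\<eta> (Suc i)\<close> is an empty sum, hence
    0.\<close>
  have x_eq: "x i = \<eta> i + c *\<^sub>R (\<nu> * \<eta> (Suc i))" if "i < n" for i
  proof -
    have "(\<Sum>j=Suc i..<n. (- of_real c * \<nu>) ^ (j - i) * x j) = (- of_real c * \<nu>) * \<eta> (Suc i)"
      unfolding \<eta>_def sum_distrib_left
    proof (rule sum.cong)
      fix j assume "j \<in> {Suc i..<n}"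
      then have "j - i = Suc (j - Suc i)" by auto
      then show "(- of_real c * \<nu>) ^ (j - i) * x j
          = - of_real c * \<nu> * ((- of_real c * \<nu>) ^ (j - Suc i) * x j)" by simp
    qed simp
    then have "\<eta> i = x i + (- of_real c * \<nu>) * \<eta> (Suc i)"
      using that by (simp add: \<eta>_def[of i] sum.atLeast_Suc_lessThan)
    then show ?thesis by (simp add: scaleR_conv_of_real algebra_simps)
  qed
  have y_eq: "y i = c *\<^sub>R \<eta> i + \<nu> * \<eta> (Suc i)" if "i < n" for i
  proof -
    have "(\<Sum>j=Suc i..<n. moebius_coeff c \<nu> (j - i) * x j) = of_real (1 - c\<^sup>2) * \<nu> * \<eta> (Suc i)"
      unfolding \<eta>_def sum_distrib_left
    proof (rule sum.cong)
      fix j assume "j \<in> {Suc i..<n}"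
      then have "j - i = Suc (j - Suc i)" by auto
      then show "moebius_coeff c \<nu> (j - i) * x j
          = of_real (1 - c\<^sup>2) * \<nu> * ((- of_real c * \<nu>) ^ (j - Suc i) * x j)"
        by (simp add: moebius_coeff_def)
    qed simp
    then have "y i = of_real c * x i + of_real (1 - c\<^sup>2) * \<nu> * \<eta> (Suc i)"
      using that by (simp add: y_def[of i] sum.atLeast_Suc_lessThan moebius_coeff_def)
    then show ?thesis
      by (simp add: x_eq[OF that] scaleR_conv_of_real algebra_simps power2_eq_square)
  qed
  have c2: "0 \<le> 1 - c\<^sup>2" using c by (simp add: power_le_one)
  \<comment> \<open>By \<open>moebius_norm_diff\<close> the right side is the left side with
    \<open>\<nu> * \<eta> (Suc i)\<close> in place of \<open>\<eta> (Suc i)\<close>, and |\<nu>|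
    \<le> 1.\<close>
  have "(1 - c\<^sup>2) * ((norm (\<eta> i))\<^sup>2 - (norm (\<eta> (Suc i)))\<^sup>2) \<le> (norm (x i))\<^sup>2 - (norm (y i))\<^sup>2"
    if "i < n" for i
  proof -
    have "norm (\<nu> * \<eta> (Suc i)) \<le> norm (\<eta> (Suc i))"
      using \<nu> by (simp add: norm_mult mult_left_le_one_le)
    then have "(norm (\<nu> * \<eta> (Suc i)))\<^sup>2 \<le> (norm (\<eta> (Suc i)))\<^sup>2" by (intro power_mono) auto
    then show ?thesis
      unfolding x_eq[OF that] y_eq[OF that] moebius_norm_diff using c2 by (intro mult_left_mono) auto
  qed
  then have "(\<Sum>i<n. (1 - c\<^sup>2) * ((norm (\<eta> i))\<^sup>2 - (norm (\<eta> (Suc i)))\<^sup>2))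
      \<le> (\<Sum>i<n. (norm (x i))\<^sup>2 - (norm (y i))\<^sup>2)"
    by (intro sum_mono) auto
  \<comment> \<open>The sum telescopes, and \<open>\<eta> n\<close> is an empty sum, so only the
    term of \<open>\<eta> 0\<close> survives.\<close>
  moreover have "(\<Sum>i<n. (1 - c\<^sup>2) * ((norm (\<eta> i))\<^sup>2 - (norm (\<eta> (Suc i)))\<^sup>2))
      = (1 - c\<^sup>2) * (norm (\<eta> 0))\<^sup>2"
    using sum_lessThan_telescope'[of "\<lambda>i. (norm (\<eta> i))\<^sup>2" n] \<eta>_def[of n]
    by (simp add: sum_distrib_left[symmetric])
  moreover have "0 \<le> (1 - c\<^sup>2) * (norm (\<eta> 0))\<^sup>2" using c2 by simp
  ultimately show ?thesis by (simp add: sum_subtractf y_def)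
qed

section \<open>Toeplitz operators with multiplication entries\<close>

lemma L2_class_cases:
  obtains f where "square_integrable f" "X = L2_class f"
proof -
  have "\<exists>f. square_integrable f \<and> X = L2_class f"
    by transfer (auto simp: L2_rel_def)
  then show thesis using that by blast
qed

lemma L2_class_zero: "L2_class (\<lambda>z. 0) = 0"
  by transfer (simp add: L2_rel_def square_integrable_zero)

lemma L2_class_add:
  assumes "square_integrable f" "square_integrable g"
  shows "L2_class (\<lambda>z. f z + g z) = L2_class f + L2_class g"
  using assms by transfer (simp add: L2_rel_def square_integrable_add)

lemma
  assumes "\<And>i. i \<in> I \<Longrightarrow> square_integrable (f i)"
  shows square_integrable_sum: "square_integrable (\<lambda>z. \<Sum>i\<in>I. f i z)"
    and L2_class_sum: "L2_class (\<lambda>z. \<Sum>i\<in>I. f i z) = (\<Sum>i\<in>I. L2_class (f i))"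
proof -
  have "square_integrable (\<lambda>z. \<Sum>i\<in>I. f i z) \<and>
      L2_class (\<lambda>z. \<Sum>i\<in>I. f i z) = (\<Sum>i\<in>I. L2_class (f i))"
    using assms
    by (induction I rule: infinite_finite_induct)
      (auto simp: square_integrable_zero L2_class_zero square_integrable_add L2_class_add)
  then show "square_integrable (\<lambda>z. \<Sum>i\<in>I. f i z)"
    "L2_class (\<lambda>z. \<Sum>i\<in>I. f i z) = (\<Sum>i\<in>I. L2_class (f i))" by auto
qed

lemma square_integrable_poly_mult:
  assumes "square_integrable f"
  shows "square_integrable (\<lambda>z. poly p z * f z)"
  using ess_bounded_poly[of p] square_integrable_mult[OF assms] by (auto simp: ess_bounded_def)

lemma tuple_norm_L2_class:
  assumes "\<And>i. i < n \<Longrightarrow> square_integrable (f i)"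
  shows "tuple_norm n (\<lambda>i. L2_class (f i))
    = sqrt (\<integral>z. (\<Sum>i<n. (norm (f i z))\<^sup>2) \<partial>circle_measure)"
proof -
  have "(\<integral>z. (\<Sum>i<n. (norm (f i z))\<^sup>2) \<partial>circle_measure)
      = (\<Sum>i<n. \<integral>z. (norm (f i z))\<^sup>2 \<partial>circle_measure)"
    using assms by (intro Bochner_Integration.integral_sum) (auto simp: square_integrable_def)
  also have "\<dots> = (\<Sum>i<n. (norm (L2_class (f i)))\<^sup>2)"
    using assms by (intro sum.cong) (auto simp: norm_circle_L2 integral_nonneg_AE)
  finally show ?thesis by (simp add: tuple_norm_def L2_set_def)
qed

lemma toeplitz_mult_ops_L2_class:
  assumes "\<And>j. j < length ps \<Longrightarrow> square_integrable (f j)"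
    and x: "\<And>j. j < length ps \<Longrightarrow> x j = L2_class (f j)"
  shows "toeplitz (mult_ops ps) x i =
    L2_class (\<lambda>z. \<Sum>j=i..<length ps. poly (ps ! (j - i)) z * f j z)"
proof -
  have "toeplitz (mult_ops ps) x i
      = (\<Sum>j<length ps. if i \<le> j then L2_class (\<lambda>z. poly (ps ! (j - i)) z * f j z) else 0)"
    unfolding toeplitz_def block_op_def
    using assms by (auto intro!: sum.cong simp: mult_ops_def mult_op_poly)
  also have "\<dots> = (\<Sum>j=i..<length ps. L2_class (\<lambda>z. poly (ps ! (j - i)) z * f j z))"
    by (rule sum.mono_neutral_cong_right) auto
  finally show ?thesis
    using assms(1) by (subst L2_class_sum) (auto intro: square_integrable_poly_mult)
qed

text \<open>Multiplication operators act pointwise, so the block operator applies a scalar Toeplitz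
  matrix at each point z of the circle. Integrating the pointwise contraction inequality bounds its
  norm.\<close>

lemma toeplitz_mult_ops_norm_le_1:
  assumes contr: "\<And>z x. norm z = 1 \<Longrightarrow>
    (\<Sum>i<length ps. (norm (\<Sum>j=i..<length ps. poly (ps ! (j - i)) z * x j))\<^sup>2)
      \<le> (\<Sum>i<length ps. (norm (x i))\<^sup>2)"
  shows "toeplitz_norm (mult_ops ps) \<le> 1"
proof -
  define n where "n = length ps"
  have "tuple_norm n (toeplitz (mult_ops ps) x) \<le> tuple_norm n x" for x
  proof -
    have "\<forall>j. \<exists>f. square_integrable f \<and> x j = L2_class f"
      using L2_class_cases by metis
    then obtain f where f: "\<And>j. square_integrable (f j)" and x: "x = (\<lambda>j. L2_class (f j))"
      by metis
    define g where "g i z = (\<Sum>j=i..<n. poly (ps ! (j - i)) z * f j z)" for i z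
    have g: "square_integrable (g i)" for i
      unfolding g_def using f by (intro square_integrable_sum square_integrable_poly_mult)
    have Tx: "toeplitz (mult_ops ps) x = (\<lambda>i. L2_class (g i))"
      using f unfolding g_def n_def by (intro ext toeplitz_mult_ops_L2_class) (auto simp: x)
    have "(\<integral>z. (\<Sum>i<n. (norm (g i z))\<^sup>2) \<partial>circle_measure)
        \<le> (\<integral>z. (\<Sum>i<n. (norm (f i z))\<^sup>2) \<partial>circle_measure)"
    proof (rule integral_mono)
      fix z assume "z \<in> space circle_measure"
      then have "norm z = 1" by (simp add: circle_measure_def space_restrict_space)
      from contr[OF this] show "(\<Sum>i<n. (norm (g i z))\<^sup>2) \<le> (\<Sum>i<n. (norm (f i z))\<^sup>2)"
        unfolding g_def n_def .
    qed (use f g in \<open>auto simp: square_integrable_def\<close>)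
    then show ?thesis
      unfolding Tx unfolding x using f g by (simp add: tuple_norm_L2_class)
  qed
  then have "tuple_norm n (toeplitz (mult_ops ps) x) \<le> 1" if "tuple_norm n x \<le> 1" for x
    using that order_trans by blast
  then show ?thesis
    by (auto simp: toeplitz_norm_def block_op_norm_def n_def mult_ops_def intro!: SUP_least)
qed

section \<open>The polynomial extension\<close>

text \<open>The rotation turns b into the direction of a, which gives equality in the triangle
  inequality. The polar form also covers zero values.\<close>

lemma norm_add_mult_cis_Arg_diff:
  "norm (a + b * cis (Arg a - Arg b)) = norm a + norm b"
proof -
  have "a = of_real (norm a) * cis (Arg a)" for a :: complex
    by (metis rcis_cmod_Arg rcis_def)
  then have "b * cis (Arg a - Arg b) = of_real (norm b) * (cis (Arg b) * cis (Arg a - Arg b))"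
    by (metis mult.assoc)
  also have "\<dots> = of_real (norm b) * cis (Arg a)" by (simp add: cis_mult)
  also have "a + \<dots> = of_real (norm a + norm b) * cis (Arg a)"
    using \<open>a = of_real (norm a) * cis (Arg a)\<close> by (simp add: algebra_simps)
  finally show ?thesis by (simp add: norm_mult del: of_real_add)
qed

lemma cis_cong_rmod:
  assumes "[x = y] (rmod (2 * pi))"
  shows "cis x = cis y"
proof -
  from assms obtain k :: int where "y = x + 2 * pi * of_int k"
    by (auto simp: rcong_altdef mult.commute)
  then show ?thesis by (simp add: cis_mult[symmetric] cis_multiple_2pi)
qed

lemma extendible_pair:
  fixes \<alpha> \<beta> \<gamma> \<delta> :: complex
  assumes bound: "(norm \<gamma> + norm \<delta>)\<^sup>2 + (norm \<alpha> + norm \<beta>) * (norm \<gamma> + norm \<delta>) \<le> 1"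
  shows "completely_poly_extendible [[:\<gamma>, \<delta>:], [:\<alpha>, \<beta>:] * [:\<gamma>, \<delta>:]]"
proof -
  define C where "C = norm \<gamma> + norm \<delta>"
  define A where "A = norm \<alpha> + norm \<beta>"
  define M where "M = [:\<alpha>, \<beta>:]"
  define p where "p = [:\<gamma>, \<delta>:]"
  text \<open>If \<open>C = 1\<close> then \<open>M = 0\<close>, and the junk value \<open>r = 0\<close> is as good as any other.\<close>
  define r where "r = C / (1 - C\<^sup>2)"
  \<comment> \<open>With \<nu> = r M this is p M (-C \<nu>)^l. It stands in position l + 2 counted
    from 1, and \<open>q 0\<close> is the given second polynomial.\<close>
  define q where "q l = M * p * (smult (- of_real (C * r)) M) ^ l" for l
  define ps where "ps m = p # map q [0..<m]" for m
  have C0: "0 \<le> C" and A0: "0 \<le> A" by (auto simp: C_def A_def)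
  have CA: "C\<^sup>2 + A * C \<le> 1" using bound by (simp add: C_def A_def)
  then have "C\<^sup>2 \<le> 1" using C0 A0 mult_nonneg_nonneg[of A C] by linarith
  then have C1: "C \<le> 1" using C0 by (simp add: power_le_one_iff)
  have contr: "toeplitz_norm (mult_ops (ps m)) \<le> 1" for m
  proof (rule toeplitz_mult_ops_norm_le_1)
    fix z :: complex and x :: "nat \<Rightarrow> complex" assume z: "norm z = 1"
    define a where "a = poly p z"
    define \<mu> where "\<mu> = poly M z"
    define \<nu> where "\<nu> = of_real r * \<mu>"
    have a: "norm a \<le> C" and \<mu>: "norm \<mu> \<le> A"
      using z norm_triangle_ineq[of \<gamma> "z * \<delta>"] norm_triangle_ineq[of \<alpha> "z * \<beta>"]
      by (auto simp: a_def p_def C_def \<mu>_def M_def A_def norm_mult)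
    have \<nu>: "norm \<nu> \<le> 1" and \<mu>\<nu>: "of_real C * \<mu> = of_real (1 - C\<^sup>2) * \<nu>"
    proof -
      have "norm \<nu> \<le> 1 \<and> of_real C * \<mu> = of_real (1 - C\<^sup>2) * \<nu>"
      proof (cases "C = 1")
        case True
        with CA have "A \<le> 0" by simp
        with \<mu> have "norm \<mu> \<le> 0" by (rule order_trans)
        then have "\<mu> = 0" by simp
        then show ?thesis by (simp add: \<nu>_def)
      next
        case False
        with C0 C1 have pos: "0 < 1 - C\<^sup>2"
          using abs_square_less_1[of C] by auto
        \<comment> \<open>The factor \<open>r\<close> is scaled so that \<open>CA\<close>, read as A
          C \<le> 1 - C^2, becomes |\<nu>| \<le> 1.\<close>
        have "norm \<nu> = C * norm \<mu> / (1 - C\<^sup>2)"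
          using C0 pos by (simp add: \<nu>_def r_def norm_mult norm_divide
              del: of_real_diff of_real_power of_real_divide)
        also have "C * norm \<mu> \<le> C * A" using \<mu> C0 by (rule mult_left_mono)
        then have "C * norm \<mu> / (1 - C\<^sup>2) \<le> 1"
          using CA pos by (simp add: mult.commute)
        finally have "norm \<nu> \<le> 1" .
        moreover have "C = (1 - C\<^sup>2) * r" using pos by (simp add: r_def)
        then have "(of_real C :: complex) = of_real ((1 - C\<^sup>2) * r)" by (rule arg_cong)
        then have "of_real C * \<mu> = of_real (1 - C\<^sup>2) * \<nu>"
          by (simp only: \<nu>_def of_real_mult mult.assoc)
        ultimately show ?thesis by simp
      qed
      then show "norm \<nu> \<le> 1" "of_real C * \<mu> = of_real (1 - C\<^sup>2) * \<nu>" by auto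
    qed
    \<comment> \<open>If C = 0 then a = 0, and division by zero gives u = 0, so a = u C
      persists.\<close>
    define u where "u = a / of_real C"
    have au: "a = u * of_real C" using a by (auto simp: u_def)
    have u: "norm u \<le> 1"
      using a C0 by (auto simp: u_def norm_divide divide_le_eq_1 less_le)
    have coeff: "poly (ps m ! k) z = u * moebius_coeff C \<nu> k" if "k < length (ps m)" for k
    proof (cases k)
      case 0
      then show ?thesis using au by (simp add: ps_def moebius_coeff_def a_def)
    next
      case (Suc l)
      have "poly (q l) z = \<mu> * a * (- of_real (C * r) * \<mu>) ^ l"
        by (simp add: q_def a_def \<mu>_def poly_power del: of_real_mult)
      also have "\<mu> * a = u * (of_real C * \<mu>)" by (simp add: au)
      also have "- of_real (C * r) * \<mu> = - of_real C * \<nu>" by (simp add: \<nu>_def)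
      finally show ?thesis
        using that Suc by (simp add: ps_def moebius_coeff_def \<mu>\<nu> mult.assoc del: of_real_diff)
    qed
    let ?n = "length (ps m)"
    have "(\<Sum>j=i..<?n. poly (ps m ! (j - i)) z * x j)
        = u * (\<Sum>j=i..<?n. moebius_coeff C \<nu> (j - i) * x j)" for i
      unfolding sum_distrib_left by (rule sum.cong) (auto simp: coeff mult.assoc)
    then have "(\<Sum>i<?n. (norm (\<Sum>j=i..<?n. poly (ps m ! (j - i)) z * x j))\<^sup>2)
        \<le> (\<Sum>i<?n. (norm (\<Sum>j=i..<?n. moebius_coeff C \<nu> (j - i) * x j))\<^sup>2)"
      using u by (auto intro!: sum_mono power_mono mult_left_le_one_le simp: norm_mult)
    also have "\<dots> \<le> (\<Sum>i<?n. (norm (x i))\<^sup>2)"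
      using C0 C1 \<nu> by (rule moebius_toeplitz_contractive)
    finally show "(\<Sum>i<?n. (norm (\<Sum>j=i..<?n. poly (ps m ! (j - i)) z * x j))\<^sup>2)
        \<le> (\<Sum>i<?n. (norm (x i))\<^sup>2)" .
  qed
  have deg: "degree (q l) \<le> l + 2" for l
  proof -
    have M: "degree M \<le> 1" and p: "degree p \<le> 1" by (auto simp: M_def p_def)
    have "degree (smult (- of_real (C * r)) M ^ l) \<le> degree (smult (- of_real (C * r)) M) * l"
      by (rule degree_power_le)
    also have "\<dots> \<le> 1 * l" using M degree_smult_le[of "- of_real (C * r)" M]
      by (intro mult_right_mono) (auto intro: order_trans)
    finally show ?thesis
      using degree_mult_le[of M p] degree_mult_le[of "M * p" "smult (- of_real (C * r)) M ^ l"] M p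
      unfolding q_def by linarith
  qed
  have pair: "[p, M * p] = ps 1" by (simp add: ps_def q_def)
  have "poly_extendible m [p, M * p]" if "2 \<le> m" for m
    unfolding poly_extendible_def
  proof (intro conjI exI)
    \<comment> \<open>The first new polynomial is \<open>q 1\<close>; the m polynomials in all are p
      and \<open>q 0\<close> to \<open>q (m - 2)\<close>.\<close>
    let ?qs = "map q [1..<m - 1]"
    have eq: "[p, M * p] @ ?qs = ps (m - 1)"
      using that upt_conv_Cons[of 0 "m - 1"] by (simp add: ps_def q_def)
    show "toeplitz_norm (mult_ops [p, M * p]) \<le> 1" unfolding pair by (rule contr)
    show "length [p, M * p] + length ?qs = m" using that by simp
    show "toeplitz_norm (mult_ops ([p, M * p] @ ?qs)) \<le> 1" unfolding eq by (rule contr)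
    show "\<forall>l\<in>{length [p, M * p] + 1..m}. degree (([p, M * p] @ ?qs) ! (l - 1)) \<le> l"
    proof
      fix l assume l: "l \<in> {length [p, M * p] + 1..m}"
      then have "ps (m - 1) ! (l - 1) = q (l - 2)"
        by (auto simp: ps_def nth_Cons' numeral_2_eq_2)
      then show "degree (([p, M * p] @ ?qs) ! (l - 1)) \<le> l"
        unfolding eq using deg[of "l - 2"] l by auto
    qed
  qed
  then show ?thesis by (auto simp: completely_poly_extendible_def p_def M_def)
qed

theorem theorem3p5:
  fixes \<alpha> \<beta> \<gamma> \<delta> :: complex and p1 p2 :: "complex poly"
  assumes "p1 = [:\<gamma>, \<delta>:]"
    and "p2 = [:\<alpha>, \<beta>:] * [:\<gamma>, \<delta>:]"
    and "\<forall>z\<in>ball 0 1. (norm (poly p1 z))\<^sup>2 + norm (poly p2 z) \<le> 1"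
    and "\<alpha> * \<beta> * \<gamma> * \<delta> = 0 \<or> [Arg \<alpha> - Arg \<beta> = Arg \<gamma> - Arg \<delta>] (rmod (2 * pi))"
  shows "completely_poly_extendible [p1, p2]"
proof -
  obtain z where z: "norm z = 1" "norm (\<gamma> + \<delta> * z) = norm \<gamma> + norm \<delta>"
    "norm (\<alpha> + \<beta> * z) = norm \<alpha> + norm \<beta>"
  \<comment> \<open>A sum with a vanishing coefficient has constant modulus on the circle, so z can
    be chosen for the other sum. If no coefficient vanishes, the argument condition makes the two
    optimal rotations equal.\<close>
  proof (cases "\<gamma> = 0 \<or> \<delta> = 0")
    case True
    then show thesis
      using that[of "cis (Arg \<alpha> - Arg \<beta>)"] norm_add_mult_cis_Arg_diff[of \<alpha> \<beta>]
      by (auto simp: norm_mult)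
  next
    case False
    then have "\<alpha> = 0 \<or> \<beta> = 0 \<or> cis (Arg \<gamma> - Arg \<delta>) = cis (Arg \<alpha> - Arg \<beta>)"
      using assms(4) cis_cong_rmod by fastforce
    then have "norm (\<alpha> + \<beta> * cis (Arg \<gamma> - Arg \<delta>)) = norm \<alpha> + norm \<beta>"
      using norm_add_mult_cis_Arg_diff[of \<alpha> \<beta>] by (auto simp: norm_mult)
    then show thesis
      using that[of "cis (Arg \<gamma> - Arg \<delta>)"] norm_add_mult_cis_Arg_diff[of \<gamma> \<delta>] by auto
  qed
  \<comment> \<open>The point z lies on the circle, so the hypothesis on the open disc is extended
    by continuity.\<close>
  have "(norm (poly p1 z))\<^sup>2 + norm (poly p2 z) \<le> 1"
  proof (rule continuous_le_on_closure[where S = "ball 0 1"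
        and f = "\<lambda>z. (norm (poly p1 z))\<^sup>2 + norm (poly p2 z)"])
    show "z \<in> closure (ball 0 1)" using z by simp
  qed (use assms(3) in \<open>auto intro!: continuous_intros\<close>)
  then have "(norm \<gamma> + norm \<delta>)\<^sup>2 + (norm \<alpha> + norm \<beta>) * (norm \<gamma> + norm \<delta>) \<le> 1"
    using z unfolding assms(1,2) poly_mult by (simp add: norm_mult mult.commute[of z])
  then show ?thesis unfolding assms(1,2) by (rule extendible_pair)
qed

end
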